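(* Let $\mathcal{T}=(t_{ijkl})\in\mathcal{E}_{4,3}$ with $t_{iiii}=0$ for all $i\in\{1,2,3\}$. Then $\mathcal{T}$ is positive semi-definite if and only if $t_{iiij}=0$ for all $i,j\in\{1,2,3\}$ with $i\neq j$, and one of the following conditions is satisfied. (a) $t_{1123}=t_{1223}=t_{1233}=t_{1122}=t_{1133}=t_{2233}=1$. (b) $t_{1123}=t_{1223}=t_{1233}=0$ and $t_{iijj}\in\{0,1\}$ for all $i,j\in\{1,2,3\}$ with $i\neq j$. (c) Two of $t_{1123},t_{1223},t_{1233}$ are $-1$ and the third one is $1$, and $t_{1122}=t_{1133}=t_{2233}=1$. (d) There is a permutation $(i,j,k)$ of $(1,2,3)$ such that $t_{iijk}\in\{-1,1\}$, $t_{ijjk}=t_{ijkk}=0$, $t_{iijj}=t_{iikk}=1$ and $t_{jjkk}\in\{0,1\}$.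
   Context: A 4th order 3-dimensional real tensor $\mathcal{T}=(t_{ijkl})_{i,j,k,l\in\{1,2,3\}}$ is symmetric if its entries are invariant under all permutations of the four indices (so, e.g., $t_{ijjk}$ denotes the common value of all entries whose index multiset is $\{i,j,j,k\}$). $\mathcal{E}_{4,3}$ is the set of symmetric 4th order 3-dimensional tensors all of whose entries lie in $\{-1,0,1\}$. For $x\in\mathbb{R}^3$ put $\mathcal{T}x^4=\sum_{i,j,k,l=1}^3 t_{ijkl}x_ix_jx_kx_l$. $\mathcal{T}$ is positive semi-definite if $\mathcal{T}x^4\ge 0$ for all $x\in\mathbb{R}^3$. *)

theory Defs
  imports "HOL-Analysis.Analysis" "HOL-Combinatorics.Permutations"
begin

text \<open>The index set is the three-element numeral type \<open>3\<close>, whose elements are \<open>1\<close>, \<open>2\<close>, \<open>3\<close>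
  (arithmetic is modulo 3, so \<open>3 = 0\<close> there; only the distinctness of the three matters).\<close>

type_synonym tensor43 = "3 \<Rightarrow> 3 \<Rightarrow> 3 \<Rightarrow> 3 \<Rightarrow> real"

text \<open>In the following definition \<open>v\<close> lists the four indices as \<open>v 1, v 2, v 3, v 4\<close>, and \<open>\<pi>\<close>
  permutes the four positions.\<close>

definition symmetric_tensor :: "tensor43 \<Rightarrow> bool" where
  "symmetric_tensor t \<longleftrightarrow>
     (\<forall>\<pi> (v :: nat \<Rightarrow> 3). \<pi> permutes {1..4} \<longrightarrow>
        t (v (\<pi> 1)) (v (\<pi> 2)) (v (\<pi> 3)) (v (\<pi> 4)) = t (v 1) (v 2) (v 3) (v 4))"

definition E43 :: "tensor43 set" where
  "E43 = {t. symmetric_tensor t \<and> (\<forall>i j k l. t i j k l \<in> {-1, 0, 1})}"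

definition tensor_form :: "tensor43 \<Rightarrow> real ^ 3 \<Rightarrow> real" where
  "tensor_form t x =
     (\<Sum>i\<in>UNIV. \<Sum>j\<in>UNIV. \<Sum>k\<in>UNIV. \<Sum>l\<in>UNIV. t i j k l * x $ i * x $ j * x $ k * x $ l)"

definition positive_semidefinite :: "tensor43 \<Rightarrow> bool" where
  "positive_semidefinite t \<longleftrightarrow> (\<forall>x. tensor_form t x \<ge> 0)"

end

theory Submission
  imports Defs
begin

text \<open>Restricting to a coordinate plane forces \<open>t\<^sub>i\<^sub>i\<^sub>i\<^sub>j = 0\<close> and \<open>t\<^sub>i\<^sub>i\<^sub>j\<^sub>j \<ge> 0\<close>. In the variables
  \<open>u = xy\<close>, \<open>v = xz\<close>, \<open>w = yz\<close> the remaining quartic is six times the quadratic form with matrix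
  \<open>(t\<^sub>1\<^sub>1\<^sub>2\<^sub>2, t\<^sub>1\<^sub>1\<^sub>2\<^sub>3, t\<^sub>1\<^sub>2\<^sub>2\<^sub>3; t\<^sub>1\<^sub>1\<^sub>2\<^sub>3, t\<^sub>1\<^sub>1\<^sub>3\<^sub>3, t\<^sub>1\<^sub>2\<^sub>3\<^sub>3; t\<^sub>1\<^sub>2\<^sub>2\<^sub>3, t\<^sub>1\<^sub>2\<^sub>3\<^sub>3, t\<^sub>2\<^sub>2\<^sub>3\<^sub>3)\<close>.
  As \<open>uvw \<ge> 0\<close> can be arranged by a global sign change, which does not affect a quadratic form,
  positive semidefiniteness of the tensor is that of this matrix. For entries in \<open>{-1, 0, 1}\<close> it
  says that the diagonal is nonnegative, that a nonzero off-diagonal entry has ones in both its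
  diagonal positions, and that two nonzero off-diagonal entries force the product of all three
  to be \<open>1\<close>.\<close>

text \<open>Adjacent exchanges generate all permutations; as permutative rewrite rules they let the
  simplifier sort indices.\<close>

lemma symmetric_tensor_swaps:
  assumes "symmetric_tensor t"
  shows "t i j k l = t j i k l" "t i j k l = t i k j l" "t i j k l = t i j l k"
proof -
  define v :: "nat \<Rightarrow> 3" where
    "v = (\<lambda>n. if n = 1 then i else if n = 2 then j else if n = 3 then k else l)"
  have sym: "t (v (\<pi> 1)) (v (\<pi> 2)) (v (\<pi> 3)) (v (\<pi> 4)) = t (v 1) (v 2) (v 3) (v 4)"
    if "\<pi> permutes {1..4}" for \<pi>
    using assms that by (simp add: symmetric_tensor_def)
  have "Transposition.transpose (1::nat) 2 permutes {1..4}"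
    "Transposition.transpose (2::nat) 3 permutes {1..4}" "Transposition.transpose (3::nat) 4 permutes {1..4}"
    by (auto intro!: permutes_swap_id)
  from this[THEN sym]
  show "t i j k l = t j i k l" "t i j k l = t i k j l" "t i j k l = t i j l k"
    by (simp_all add: v_def Transposition.transpose_def)
qed

text \<open>The coefficients 1, 4, 6, 12 count the arrangements of an index multiset.\<close>

lemma tensor_form_expand:
  assumes "symmetric_tensor t"
  shows "tensor_form t x =
    t 1 1 1 1 * x$1 ^ 4 + t 2 2 2 2 * x$2 ^ 4 + t 3 3 3 3 * x$3 ^ 4
    + 4 * (t 1 1 1 2 * x$1 ^ 3 * x$2 + t 1 1 1 3 * x$1 ^ 3 * x$3
         + t 2 2 2 1 * x$2 ^ 3 * x$1 + t 2 2 2 3 * x$2 ^ 3 * x$3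
         + t 3 3 3 1 * x$3 ^ 3 * x$1 + t 3 3 3 2 * x$3 ^ 3 * x$2)
    + 6 * (t 1 1 2 2 * (x$1 * x$2)\<^sup>2 + t 1 1 3 3 * (x$1 * x$3)\<^sup>2 + t 2 2 3 3 * (x$2 * x$3)\<^sup>2)
    + 12 * x$1 * x$2 * x$3 * (t 1 1 2 3 * x$1 + t 1 2 2 3 * x$2 + t 1 2 3 3 * x$3)"
proof -
  note s = symmetric_tensor_swaps[OF assms]
  have entries:
    "t 1 1 2 1 = t 1 1 1 2" "t 1 2 1 1 = t 1 1 1 2" "t 2 1 1 1 = t 1 1 1 2"
    "t 1 1 3 1 = t 1 1 1 3" "t 1 3 1 1 = t 1 1 1 3" "t 3 1 1 1 = t 1 1 1 3"
    "t 1 2 2 2 = t 2 2 2 1" "t 2 1 2 2 = t 2 2 2 1" "t 2 2 1 2 = t 2 2 2 1"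
    "t 2 2 3 2 = t 2 2 2 3" "t 2 3 2 2 = t 2 2 2 3" "t 3 2 2 2 = t 2 2 2 3"
    "t 1 3 3 3 = t 3 3 3 1" "t 3 1 3 3 = t 3 3 3 1" "t 3 3 1 3 = t 3 3 3 1"
    "t 2 3 3 3 = t 3 3 3 2" "t 3 2 3 3 = t 3 3 3 2" "t 3 3 2 3 = t 3 3 3 2"
    "t 1 2 1 2 = t 1 1 2 2" "t 1 2 2 1 = t 1 1 2 2" "t 2 1 1 2 = t 1 1 2 2"
    "t 2 1 2 1 = t 1 1 2 2" "t 2 2 1 1 = t 1 1 2 2" "t 1 3 1 3 = t 1 1 3 3"
    "t 1 3 3 1 = t 1 1 3 3" "t 3 1 1 3 = t 1 1 3 3" "t 3 1 3 1 = t 1 1 3 3"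
    "t 3 3 1 1 = t 1 1 3 3" "t 2 3 2 3 = t 2 2 3 3" "t 2 3 3 2 = t 2 2 3 3"
    "t 3 2 2 3 = t 2 2 3 3" "t 3 2 3 2 = t 2 2 3 3" "t 3 3 2 2 = t 2 2 3 3"
    "t 1 1 3 2 = t 1 1 2 3" "t 1 2 1 3 = t 1 1 2 3" "t 1 2 3 1 = t 1 1 2 3"
    "t 1 3 1 2 = t 1 1 2 3" "t 1 3 2 1 = t 1 1 2 3" "t 2 1 1 3 = t 1 1 2 3"
    "t 2 1 3 1 = t 1 1 2 3" "t 2 3 1 1 = t 1 1 2 3" "t 3 1 1 2 = t 1 1 2 3"
    "t 3 1 2 1 = t 1 1 2 3" "t 3 2 1 1 = t 1 1 2 3" "t 1 2 3 2 = t 1 2 2 3"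
    "t 1 3 2 2 = t 1 2 2 3" "t 2 1 2 3 = t 1 2 2 3" "t 2 1 3 2 = t 1 2 2 3"
    "t 2 2 1 3 = t 1 2 2 3" "t 2 2 3 1 = t 1 2 2 3" "t 2 3 1 2 = t 1 2 2 3"
    "t 2 3 2 1 = t 1 2 2 3" "t 3 1 2 2 = t 1 2 2 3" "t 3 2 1 2 = t 1 2 2 3"
    "t 3 2 2 1 = t 1 2 2 3" "t 1 3 2 3 = t 1 2 3 3" "t 1 3 3 2 = t 1 2 3 3"
    "t 2 1 3 3 = t 1 2 3 3" "t 2 3 1 3 = t 1 2 3 3" "t 2 3 3 1 = t 1 2 3 3"
    "t 3 1 2 3 = t 1 2 3 3" "t 3 1 3 2 = t 1 2 3 3" "t 3 2 1 3 = t 1 2 3 3"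
    "t 3 2 3 1 = t 1 2 3 3" "t 3 3 1 2 = t 1 2 3 3" "t 3 3 2 1 = t 1 2 3 3"
    by (simp_all add: s)
  show ?thesis
    unfolding tensor_form_def sum_3 entries by algebra
qed

text \<open>If \<open>a\<close> is nonzero, the cubic part has size at least 96 and opposite signs
  at \<open>(3, 1)\<close> and \<open>(-3, 1)\<close>, while the square part is at most 54. The
  points \<open>(1, 3)\<close> and \<open>(1, -3)\<close> treat \<open>b\<close> alike, and
  \<open>(1, 1)\<close> then gives the sign of \<open>c\<close>.\<close>

lemma no_cubic_terms_if_binary_form_nonneg:
  fixes a b c :: real
  assumes nonneg: "\<And>x y. 4 * a * x ^ 3 * y + 6 * c * (x * y)\<^sup>2 + 4 * b * y ^ 3 * x \<ge> 0"
    and "a \<in> {-1, 0, 1}" "b \<in> {-1, 0, 1}" "c \<in> {-1, 0, 1}"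
  shows "a = 0" "b = 0" "c \<in> {0, 1}"
  using nonneg[of 3 1] nonneg[of "-3" 1] nonneg[of 1 3] nonneg[of 1 "-3"] nonneg[of 1 1] assms(2-4)
  by auto

text \<open>The quadratic form with matrix \<open>(A, p, q; p, B, r; q, r, C)\<close> at the vector
  \<open>(x * y, x * z, y * z)\<close>.\<close>

definition product_form :: "real \<Rightarrow> real \<Rightarrow> real \<Rightarrow> real \<Rightarrow> real \<Rightarrow> real \<Rightarrow> real \<Rightarrow> real \<Rightarrow> real \<Rightarrow> real" where
  "product_form A B C p q r x y z =
     A * (x * y)\<^sup>2 + B * (x * z)\<^sup>2 + C * (y * z)\<^sup>2 + 2 * x * y * z * (p * x + q * y + r * z)"

lemma product_form_nonneg_diagonal:
  assumes "\<And>x y z. product_form A B C p q r x y z \<ge> 0"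
    and "A \<in> {0, 1}" "B \<in> {0, 1}" "C \<in> {0, 1}"
    and "p \<in> {-1, 1}" "q \<in> {-1, 0, 1}" "r \<in> {-1, 0, 1}"
  shows "A = 1" "B = 1"
  \<comment> \<open>at \<open>(6, 2, - p)\<close> the products \<open>xy\<close>, \<open>xz\<close>, \<open>yz\<close> have decreasing magnitudes 12, 6, 2, so without
    the first square the term in \<open>p\<close> dominates\<close>
  using assms(1)[of 6 2 "- p"] assms(1)[of 6 "- p" 2] assms(2-)
  by (auto simp: product_form_def)

lemma product_form_nonneg_determinant:
  assumes "\<And>x y z. product_form 1 1 1 p q r x y z \<ge> 0"
    and "p \<in> {-1, 1}" "q \<in> {-1, 1}" "r \<in> {-1, 0, 1}"
  shows "p * q * r = 1"
  \<comment> \<open>the negative direction of the matrix is \<open>(2, - p, - q)\<close>; its preimage has coordinate ratios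
    \<open>\<surd>2\<close>, here replaced by \<open>3/2\<close>\<close>
  using assms(1)[of "- 3 * q" "- 3 * p" 2] assms(2-)
  by (auto simp: product_form_def)

text \<open>Exchanging two variables permutes rows and columns of the matrix alike, so results about
  \<open>p\<close> carry over to \<open>q\<close> and \<open>r\<close>.\<close>

lemma product_form_permute:
  "product_form A B C p q r x y z = product_form A C B q p r y x z"
  "product_form A B C p q r x y z = product_form C B A r q p z y x"
  by (simp_all add: product_form_def algebra_simps)

text \<open>The matrix is the outer square of the vector \<open>(1, p, q)\<close>.\<close>

lemma product_form_nonneg_rank_one:
  assumes "p \<in> {-1, 1}" "q \<in> {-1, 1}" "r = p * q"
  shows "product_form 1 1 1 p q r x y z \<ge> 0"
proof -
  have "product_form 1 1 1 p q r x y z = (x * y + p * (x * z) + q * (y * z))\<^sup>2"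
    using assms by (auto simp: product_form_def power2_eq_square algebra_simps)
  then show ?thesis by simp
qed

text \<open>The product \<open>y * z\<close> decouples, and the remaining block has rank one because
  \<open>p * p = 1\<close>.\<close>

lemma product_form_nonneg_block:
  assumes "p \<in> {-1, 1}" "C \<ge> 0"
  shows "product_form 1 1 C p 0 0 x y z \<ge> 0"
proof -
  have "product_form 1 1 C p 0 0 x y z = (x * y + p * (x * z))\<^sup>2 + C * (y * z)\<^sup>2"
    using assms(1) by (auto simp: product_form_def power2_eq_square algebra_simps)
  then show ?thesis using assms(2) by simp
qed

text \<open>The alternatives have none, three or one nonzero off-diagonal entry; exactly two would
  make their product 0 instead of 1.\<close>

lemma product_form_nonneg_iff:
  assumes A: "A \<in> {0, 1}" and B: "B \<in> {0, 1}" and C: "C \<in> {0, 1}"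
    and p: "p \<in> {-1, 0, 1}" and q: "q \<in> {-1, 0, 1}" and r: "r \<in> {-1, 0, 1}"
  shows "(\<forall>x y z. product_form A B C p q r x y z \<ge> 0) \<longleftrightarrow>
     (p = 0 \<and> q = 0 \<and> r = 0)
   \<or> (p * q * r = 1 \<and> A = 1 \<and> B = 1 \<and> C = 1)
   \<or> (p \<noteq> 0 \<and> q = 0 \<and> r = 0 \<and> A = 1 \<and> B = 1)
   \<or> (q \<noteq> 0 \<and> p = 0 \<and> r = 0 \<and> A = 1 \<and> C = 1)
   \<or> (r \<noteq> 0 \<and> p = 0 \<and> q = 0 \<and> B = 1 \<and> C = 1)" (is "?L \<longleftrightarrow> ?R")
proof
  assume ?L
  then have P1: "\<And>x y z. product_form A B C p q r x y z \<ge> 0" by blast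
  then have P2: "\<And>x y z. product_form A C B q p r x y z \<ge> 0"
    and P3: "\<And>x y z. product_form C B A r q p x y z \<ge> 0"
    by (metis product_form_permute)+
  \<comment> \<open>The exchange of \<open>y\<close> and \<open>z\<close> is composed from the two
    basic ones.\<close>
  have P4: "\<And>x y z. product_form B A C p r q x y z \<ge> 0"
    by (metis P1 product_form_permute)
  have p1: "A = 1 \<and> B = 1" if "p \<noteq> 0"
    using product_form_nonneg_diagonal[OF P1 A B C _ q r] that p by auto
  have q1: "A = 1 \<and> C = 1" if "q \<noteq> 0"
    using product_form_nonneg_diagonal[OF P2 A C B _ p r] that q by auto
  have r1: "C = 1 \<and> B = 1" if "r \<noteq> 0"
    using product_form_nonneg_diagonal[OF P3 C B A _ q p] that r by auto
  \<comment> \<open>Two nonzero off-diagonal entries together touch all three diagonal positions, so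
    the diagonal consists of ones.\<close>
  have pq: "p * q * r = 1" if "p \<noteq> 0" "q \<noteq> 0"
    using product_form_nonneg_determinant[of p q r] P1 p1 q1 that p q r by auto
  have pr: "p * r * q = 1" if "p \<noteq> 0" "r \<noteq> 0"
    using product_form_nonneg_determinant[of p r q] P4 p1 r1 that p q r by auto
  have rq: "r * q * p = 1" if "r \<noteq> 0" "q \<noteq> 0"
    using product_form_nonneg_determinant[of r q p] P3 r1 q1 that p q r by auto
  show ?R
    using p1 q1 r1 pq pr rq by (auto simp: mult_ac)
next
  assume ?R
  then consider "p = 0" "q = 0" "r = 0"
    | "p * q * r = 1" "A = 1" "B = 1" "C = 1"
    | "p \<noteq> 0" "q = 0" "r = 0" "A = 1" "B = 1"
    | "q \<noteq> 0" "p = 0" "r = 0" "A = 1" "C = 1"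
    | "r \<noteq> 0" "p = 0" "q = 0" "B = 1" "C = 1"
    by blast
  then show ?L
  proof cases
    case 1
    then show ?thesis using A B C by (auto simp: product_form_def)
  next
    case 2
    then show ?thesis using p q r product_form_nonneg_rank_one[of p q r] by auto
  next
    case 3
    then show ?thesis using p C product_form_nonneg_block[of p C] by auto
  next
    case 4
    then show ?thesis using q B product_form_nonneg_block[of q B]
      by (subst product_form_permute(1)) auto
  next
    case 5
    then show ?thesis using r A product_form_nonneg_block[of r A]
      by (subst product_form_permute(2)) auto
  qed
qed

lemma all_distinct_3:
  fixes P :: "3 \<Rightarrow> 3 \<Rightarrow> bool"
  shows "(\<forall>i j. i \<noteq> j \<longrightarrow> P i j) \<longleftrightarrow> P 1 2 \<and> P 1 3 \<and> P 2 1 \<and> P 2 3 \<and> P 3 1 \<and> P 3 2"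
  by (auto simp: forall_3)

lemma ex_distinct_3:
  fixes P :: "3 \<Rightarrow> 3 \<Rightarrow> 3 \<Rightarrow> bool"
  shows "(\<exists>i j k. distinct [i, j, k] \<and> P i j k) \<longleftrightarrow>
    P 1 2 3 \<or> P 1 3 2 \<or> P 2 1 3 \<or> P 2 3 1 \<or> P 3 1 2 \<or> P 3 2 1"
proof -
  have "(\<forall>i j k. \<not> (distinct [i, j, k] \<and> P i j k)) \<longleftrightarrow>
    \<not> (P 1 2 3 \<or> P 1 3 2 \<or> P 2 1 3 \<or> P 2 3 1 \<or> P 3 1 2 \<or> P 3 2 1)"
    by (auto simp: forall_3)
  then show ?thesis by blast
qed

theorem corollary3p1:
  fixes t :: tensor43
  assumes "t \<in> E43"
    and "\<forall>i. t i i i i = 0"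
  shows "positive_semidefinite t \<longleftrightarrow>
    (\<forall>i j. i \<noteq> j \<longrightarrow> t i i i j = 0) \<and>
    ((t 1 1 2 3 = 1 \<and> t 1 2 2 3 = 1 \<and> t 1 2 3 3 = 1 \<and>
      t 1 1 2 2 = 1 \<and> t 1 1 3 3 = 1 \<and> t 2 2 3 3 = 1)
     \<or> (t 1 1 2 3 = 0 \<and> t 1 2 2 3 = 0 \<and> t 1 2 3 3 = 0 \<and>
        (\<forall>i j. i \<noteq> j \<longrightarrow> t i i j j \<in> {0, 1}))
     \<or> (((t 1 1 2 3 = -1 \<and> t 1 2 2 3 = -1 \<and> t 1 2 3 3 = 1) \<or>
         (t 1 1 2 3 = -1 \<and> t 1 2 2 3 = 1 \<and> t 1 2 3 3 = -1) \<or>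
         (t 1 1 2 3 = 1 \<and> t 1 2 2 3 = -1 \<and> t 1 2 3 3 = -1)) \<and>
        t 1 1 2 2 = 1 \<and> t 1 1 3 3 = 1 \<and> t 2 2 3 3 = 1)
     \<or> (\<exists>i j k. distinct [i, j, k] \<and>
          t i i j k \<in> {-1, 1} \<and> t i j j k = 0 \<and> t i j k k = 0 \<and>
          t i i j j = 1 \<and> t i i k k = 1 \<and> t j j k k \<in> {0, 1}))"
proof -
  have S: "symmetric_tensor t" and E: "\<And>i j k l. t i j k l \<in> {-1, 0, 1}"
    using assms(1) by (auto simp: E43_def)
  note s = symmetric_tensor_swaps[OF S]
  have form: "tensor_form t x =
      4 * (t 1 1 1 2 * x$1 ^ 3 * x$2 + t 1 1 1 3 * x$1 ^ 3 * x$3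
         + t 2 2 2 1 * x$2 ^ 3 * x$1 + t 2 2 2 3 * x$2 ^ 3 * x$3
         + t 3 3 3 1 * x$3 ^ 3 * x$1 + t 3 3 3 2 * x$3 ^ 3 * x$2)
    + 6 * product_form (t 1 1 2 2) (t 1 1 3 3) (t 2 2 3 3) (t 1 1 2 3) (t 1 2 2 3) (t 1 2 3 3)
        (x$1) (x$2) (x$3)" for x
    using assms(2) by (simp add: tensor_form_expand[OF S] product_form_def algebra_simps)
  have swap: "t 2 2 1 1 = t 1 1 2 2" "t 3 3 1 1 = t 1 1 3 3" "t 3 3 2 2 = t 2 2 3 3"
    "t 1 1 3 2 = t 1 1 2 3" "t 1 3 2 2 = t 1 2 2 3" "t 1 3 3 2 = t 1 2 3 3"
    "t 2 2 1 3 = t 1 2 2 3" "t 2 1 1 3 = t 1 1 2 3" "t 2 1 3 3 = t 1 2 3 3"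
    "t 2 2 3 1 = t 1 2 2 3" "t 2 3 1 1 = t 1 1 2 3" "t 2 3 3 1 = t 1 2 3 3"
    "t 3 3 1 2 = t 1 2 3 3" "t 3 1 1 2 = t 1 1 2 3" "t 3 1 2 2 = t 1 2 2 3"
    "t 3 3 2 1 = t 1 2 3 3" "t 3 2 1 1 = t 1 1 2 3" "t 3 2 2 1 = t 1 2 2 3"
    by (simp_all add: s)
  have psd: "positive_semidefinite t \<longleftrightarrow>
    (\<forall>i j. i \<noteq> j \<longrightarrow> t i i i j = 0) \<and> (\<forall>i j. i \<noteq> j \<longrightarrow> t i i j j \<in> {0, 1}) \<and>
    (\<forall>x y z. product_form (t 1 1 2 2) (t 1 1 3 3) (t 2 2 3 3)
       (t 1 1 2 3) (t 1 2 2 3) (t 1 2 3 3) x y z \<ge> 0)" (is "_ \<longleftrightarrow> ?cubic \<and> ?square \<and> ?prod")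
  proof
    assume "positive_semidefinite t"
    then have nonneg: "tensor_form t (vector [x, y, z]) \<ge> 0" for x y z
      by (simp add: positive_semidefinite_def)
    \<comment> \<open>On a coordinate plane all terms containing the third variable vanish, which
      leaves a binary form.\<close>
    have "0 \<le> 4 * t 1 1 1 2 * x ^ 3 * y + 6 * t 1 1 2 2 * (x * y)\<^sup>2 + 4 * t 2 2 2 1 * y ^ 3 * x"
      for x y using nonneg[of x y 0] by (simp add: form product_form_def algebra_simps)
    note c12 = no_cubic_terms_if_binary_form_nonneg[OF this E E E]
    have "0 \<le> 4 * t 1 1 1 3 * x ^ 3 * y + 6 * t 1 1 3 3 * (x * y)\<^sup>2 + 4 * t 3 3 3 1 * y ^ 3 * x"
      for x y using nonneg[of x 0 y] by (simp add: form product_form_def algebra_simps)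
    note c13 = no_cubic_terms_if_binary_form_nonneg[OF this E E E]
    have "0 \<le> 4 * t 2 2 2 3 * x ^ 3 * y + 6 * t 2 2 3 3 * (x * y)\<^sup>2 + 4 * t 3 3 3 2 * y ^ 3 * x"
      for x y using nonneg[of 0 x y] by (simp add: form product_form_def algebra_simps)
    note c23 = no_cubic_terms_if_binary_form_nonneg[OF this E E E]
    have ?prod
      using nonneg by (simp add: form c12 c13 c23)
    moreover have ?cubic ?square
      unfolding all_distinct_3 swap using c12 c13 c23 by simp_all
    ultimately show "?cubic \<and> ?square \<and> ?prod" by blast
  next
    assume "?cubic \<and> ?square \<and> ?prod"
    then show "positive_semidefinite t"
      by (simp add: positive_semidefinite_def form all_distinct_3)
  qed
  show ?thesis
  \<comment> \<open>Outside this case both sides fail: each of the four alternatives also forces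
    these entries into \<open>{0, 1}\<close>.\<close>
  proof (cases "t 1 1 2 2 \<in> {0, 1} \<and> t 1 1 3 3 \<in> {0, 1} \<and> t 2 2 3 3 \<in> {0, 1}")
    case True
    then have sq: "t 1 1 2 2 \<in> {0, 1}" "t 1 1 3 3 \<in> {0, 1}" "t 2 2 3 3 \<in> {0, 1}" by blast+
    show ?thesis
      unfolding psd product_form_nonneg_iff[OF sq E E E] ex_distinct_3
        all_distinct_3[of "\<lambda>i j. t i i j j \<in> {0, 1}"] swap
      \<comment> \<open>What remains is a finite check over the 8 * 27 values of the six
        entries.\<close>
      using sq E[of 1 1 2 3] E[of 1 2 2 3] E[of 1 2 3 3]
      by (elim insertE emptyE; simp)
  next
    case False
    then show ?thesis
      unfolding psd ex_distinct_3 all_distinct_3[of "\<lambda>i j. t i i j j \<in> {0, 1}"] swap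
      by auto
  qed
qed

end
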